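(* Let $\{x_k\}$ be an iterative sequence generated by the Contracting PPA (defined in the context). Then $$\|T_\lambda(x_{k+1})\|\le O(1/A_{k+1}),\qquad \mathtt{Gap}(x_{k+1})\le O(1/A_{k+1}).$$
   Context: $\mathcal H$ is a real Hilbert space with inner product $\langle\cdot,\cdot\rangle$ and norm $\|\cdot\|$. $T$ is a (set-valued) maximally monotone operator on $\mathcal H$ such that $T^{-1}(0)=\{x:0\in Tx\}$ is nonempty and bounded. For $\lambda>0$, $J_{\lambda T}=(I+\lambda T)^{-1}$ and $T_\lambda=\frac1\lambda(I-J_{\lambda T})$ is the (single-valued) Yosida regularization. For a fixed $D>0$ and the initial point $x_0$ of the iteration, $\mathtt{Gap}(x)=\sup_{\|y-x_0\|\le D}\langle x-y,T_\lambda(y)\rangle$. Contracting PPA: given $\varepsilon>0$, $a_0>0$, $a_{k+1}\ge\varepsilon$ ($k\ge0$), $x_{-1}=x_0\in\mathcal H$, $A_{-1}=0$, set for all $k\ge 0$ $$A_k=a_k+A_{k-1},\qquad v_k=\frac{A_kx_k-A_{k-1}x_{k-1}}{a_k}.$$ For given $\lambda>0$ and $\delta_k\ge0$ with $\sum_{k\ge0}\delta_k<+\infty$, for $k=0,1,\dots$ find $x_{k+1}$ such that $$0=A_{k+1}T_\lambda(x_{k+1})-A_kT_\lambda(x_k)+v_{k+1}-v_k+g_k,$$ where $g_k\in\mathcal H$ satisfies $\|g_k\|\le\delta_k$. "$u_k\le O(r_k)$" means there is a constant $C$ independent of $k$ with $u_k\le Cr_k$ for all $k$. *)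

theory Defs
  imports "HOL-Analysis.Analysis"
begin

definition monotone_operator :: "('a::real_inner \<Rightarrow> 'a set) \<Rightarrow> bool" where
  "monotone_operator T \<longleftrightarrow>
     (\<forall>x y. \<forall>u\<in>T x. \<forall>v\<in>T y. inner (x - y) (u - v) \<ge> 0)"

definition maximally_monotone :: "('a::real_inner \<Rightarrow> 'a set) \<Rightarrow> bool" where
  "maximally_monotone T \<longleftrightarrow> monotone_operator T \<and>
     (\<forall>S. monotone_operator S \<and> (\<forall>x. T x \<subseteq> S x) \<longrightarrow> S = T)"

text \<open>
  The resolvent \<open>(I + lam T)\<^sup>-\<^sup>1\<close>. If \<open>T\<close> is maximally monotone on a Hilbert space and
  \<open>lam > 0\<close>, Minty's theorem says that the described point exists for every \<open>x\<close>; it is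
  unique by monotonicity.
\<close>
definition resolvent :: "real \<Rightarrow> ('a::real_inner \<Rightarrow> 'a set) \<Rightarrow> 'a \<Rightarrow> 'a" where
  "resolvent lam T x = (THE z. \<exists>u\<in>T z. x = z + lam *\<^sub>R u)"

definition yosida :: "real \<Rightarrow> ('a::real_inner \<Rightarrow> 'a set) \<Rightarrow> 'a \<Rightarrow> 'a" where
  "yosida lam T x = (1 / lam) *\<^sub>R (x - resolvent lam T x)"

text \<open>
  The supremum is taken in the extended reals, so that an upper bound on it bounds every
  member of the family without a separate boundedness proof.
\<close>
definition gap ::
  "real \<Rightarrow> ('a::real_inner \<Rightarrow> 'a set) \<Rightarrow> 'a \<Rightarrow> real \<Rightarrow> 'a \<Rightarrow> ereal" where
  "gap lam T x0 D x =
     (SUP y\<in>{y. norm (y - x0) \<le> D}. ereal (inner (x - y) (yosida lam T y)))"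

primrec ppa_A :: "(nat \<Rightarrow> real) \<Rightarrow> nat \<Rightarrow> real" where
  "ppa_A a 0 = a 0"
| "ppa_A a (Suc k) = a (Suc k) + ppa_A a k"

text \<open>
  \<open>v\<^sub>k = (A\<^sub>k x\<^sub>k - A\<^sub>k\<^sub>-\<^sub>1 x\<^sub>k\<^sub>-\<^sub>1) / a\<^sub>k\<close>; for \<open>k = 0\<close> the second term is zero by the
  convention \<open>A\<^sub>-\<^sub>1 = 0\<close>.
\<close>
definition ppa_v :: "(nat \<Rightarrow> real) \<Rightarrow> (nat \<Rightarrow> 'a::real_inner) \<Rightarrow> nat \<Rightarrow> 'a" where
  "ppa_v a x k = (1 / a k) *\<^sub>R
     (ppa_A a k *\<^sub>R x k - (case k of 0 \<Rightarrow> 0 | Suc j \<Rightarrow> ppa_A a j *\<^sub>R x j))"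

definition contracting_ppa ::
  "real \<Rightarrow> ('a::real_inner \<Rightarrow> 'a set) \<Rightarrow> real \<Rightarrow> (nat \<Rightarrow> real) \<Rightarrow> (nat \<Rightarrow> real) \<Rightarrow>
     (nat \<Rightarrow> 'a) \<Rightarrow> bool" where
  "contracting_ppa lam T \<epsilon> a \<delta> x \<longleftrightarrow>
     \<epsilon> > 0 \<and> a 0 > 0 \<and> (\<forall>k. a (Suc k) \<ge> \<epsilon>) \<and>
     (\<forall>k. \<delta> k \<ge> 0) \<and> summable \<delta> \<and>
     (\<exists>g. \<forall>k. norm (g k) \<le> \<delta> k \<and>
        0 = ppa_A a (Suc k) *\<^sub>R yosida lam T (x (Suc k)) - ppa_A a k *\<^sub>R yosida lam T (x k)
            + ppa_v a x (Suc k) - ppa_v a x k + g k)"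

end

theory Submission
  imports Defs
begin

text \<open>
  Write \<open>t\<^sub>k\<close> for the Yosida regularization at \<open>x\<^sub>k\<close> and fix a zero \<open>z\<close> of \<open>T\<close>. The rate comes
  from the energy \<open>E\<^sub>k = \<parallel>v\<^sub>k - z\<parallel>\<^sup>2 + 2 A\<^sub>k \<langle>x\<^sub>k - z, t\<^sub>k\<rangle>\<close>. Its second term is nonnegative, because the
  regularization is monotone and vanishes at \<open>z\<close>; and for exact steps \<open>E\<^sub>k\<close> decreases, because
  the recursion makes its increment minus a square, plus a nonpositive multiple of
  \<open>\<langle>x\<^sub>k\<^sub>+\<^sub>1 - x\<^sub>k, t\<^sub>k\<^sub>+\<^sub>1 - t\<^sub>k\<rangle> \<ge> 0\<close>. An error \<open>g\<^sub>k\<close> adds at most \<open>2 \<parallel>g\<^sub>k\<parallel> \<parallel>v\<^sub>k\<^sub>+\<^sub>1 - z\<parallel>\<close>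
  (\<open>energy_step\<close>), so that the square root of \<open>E\<^sub>k\<close> grows by at most \<open>2 \<parallel>g\<^sub>k\<parallel>\<close>
  (\<open>sqrt_gronwall_step\<close>). As the errors are summable, the \<open>v\<^sub>k\<close> are bounded (\<open>ppa_v_bounded\<close>).

  The recursion also says that \<open>A\<^sub>k t\<^sub>k + v\<^sub>k\<close> changes by \<open>- g\<^sub>k\<close> only. Telescoping therefore bounds
  \<open>A\<^sub>k t\<^sub>k\<close>, which is the first claim (\<open>ppa_residual_bounded\<close>). For the second, monotonicity
  gives \<open>\<langle>x - y, T\<^sub>\<lambda> y\<rangle> \<le> \<langle>x - y, T\<^sub>\<lambda> x\<rangle>\<close>, so that the gap at \<open>x\<^sub>k\<close> is at most
  \<open>(\<parallel>x\<^sub>k - x\<^sub>0\<parallel> + D) \<parallel>t\<^sub>k\<parallel>\<close> (\<open>gap_le_residual\<close>); the \<open>x\<^sub>k\<close> are bounded because each is a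
  weighted average of \<open>v\<^sub>0, \<dots>, v\<^sub>k\<close> (\<open>norm_average_le\<close>).

  All this presupposes that the resolvent is defined everywhere, which is Minty's theorem
  (\<open>Minty\<close>). It is proved here by maximizing a strongly concave function over the convex hull of
  the points \<open>(y, v, \<langle>y, v\<rangle>)\<close>, \<open>(y, v)\<close> in the graph (\<open>monotone_graph_common_point\<close>).
\<close>

section \<open>Minty's theorem\<close>

text \<open>
  The third component records the average of the pairings \<open>\<langle>y, v\<rangle>\<close>, which a convex combination
  of the pairs \<open>(y, v)\<close> alone would forget.
\<close>
definition hull_graph :: "('a::real_inner \<times> 'a) set \<Rightarrow> ('a \<times> 'a \<times> real) set" where
  "hull_graph G = convex hull ((\<lambda>(y, v). (y, v, inner y v)) ` G)"

text \<open>
  Monotonicity of two graph points says that \<open>\<langle>y, v'\<rangle> + \<langle>y', v\<rangle> \<le> \<langle>y, v\<rangle> + \<langle>y', v'\<rangle>\<close>. With the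
  two pairings on the right replaced by free numbers \<open>c\<close> and \<open>c'\<close>, this is affine in either point
  when the other is held fixed. It therefore passes to the hull in one argument, then in the other,
  and on the diagonal it reads \<open>\<langle>y, v\<rangle> \<le> c\<close>.
\<close>
lemma hull_graph_above_duality_pairing:
  fixes G :: "('a::real_inner \<times> 'a) set"
  assumes mono: "\<And>y v y' v'. (y, v) \<in> G \<Longrightarrow> (y', v') \<in> G \<Longrightarrow> inner (y - y') (v - v') \<ge> 0"
    and m: "(y, v, c) \<in> hull_graph G"
  shows "inner y v \<le> c"
proof -
  define H :: "'a \<times> 'a \<times> real \<Rightarrow> ('a \<times> 'a \<times> real) set" where
    "H = (\<lambda>(y, v, c). {(y', v', c'). inner y v' + inner y' v \<le> c + c'})"
  have convex_H: "convex (H p)" for p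
  proof -
    obtain y v c where p: "p = (y, v, c)" by (metis prod_cases3)
    have "H p = {q. inner (v, y, -1) q \<le> c}"
      by (auto simp: H_def p inner_commute)
    then show ?thesis by (simp add: convex_halfspace_le)
  qed
  have graph: "(y', v', inner y' v') \<in> H (y'', v'', inner y'' v'')"
    if "(y', v') \<in> G" "(y'', v'') \<in> G" for y' v' y'' v''
    using mono[OF that] by (simp add: H_def inner_diff_left inner_diff_right inner_commute)
  have sym: "q \<in> H p" if "p \<in> H q" for p q
    using that by (auto simp: H_def inner_commute add.commute)
  have "(\<lambda>(y, v). (y, v, inner y v)) ` G \<subseteq> H (y', v', inner y' v')" if "(y', v') \<in> G" for y' v'
    using graph that by auto
  then have "(y, v, c) \<in> H (y', v', inner y' v')" if "(y', v') \<in> G" for y' v'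
    using m that convex_H hull_minimal[of _ _ convex] unfolding hull_graph_def by blast
  then have "(\<lambda>(y, v). (y, v, inner y v)) ` G \<subseteq> H (y, v, c)"
    using sym by auto
  then have "(y, v, c) \<in> H (y, v, c)"
    using m convex_H hull_minimal[of _ _ convex] unfolding hull_graph_def by blast
  then show ?thesis by (simp add: H_def)
qed

lemma norm_convex_combination_squared:
  fixes p r :: "'a::real_inner"
  shows "(norm ((1 - t) *\<^sub>R p + t *\<^sub>R r))\<^sup>2 =
    (1 - t) * (norm p)\<^sup>2 + t * (norm r)\<^sup>2 - t * (1 - t) * (norm (p - r))\<^sup>2"
  by (simp add: power2_norm_eq_inner inner_add_left inner_add_right inner_diff_left
      inner_diff_right inner_commute[of r p]) algebra

text \<open>
  The inequality \<open>\<langle>z - y, z + v\<rangle> \<le> 0\<close> says that \<open>z\<close> lies in the closed ball with centre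
  \<open>(y - v) / 2\<close> and radius \<open>\<parallel>y + v\<parallel> / 2\<close>, so the claim is that all these balls have a common point.
  For a finite convex combination of the inequalities \<open>\<parallel>z - q\<^sub>i\<parallel>\<^sup>2 - r\<^sub>i\<^sup>2 \<le> 0\<close>, the left-hand side is
  minimal in \<open>z\<close> at the average \<open>q\<close> of the centres, with minimum \<open>- c - \<parallel>q\<parallel>\<^sup>2\<close>; this dual value
  is never positive, by the previous lemma. It is strongly concave on the hull, so the centres \<open>q\<close>
  along a maximizing sequence form a Cauchy sequence. The first-order condition for a maximum,
  tested in the direction of a single point of the graph, says that the limit lies in the ball of
  that point. Completeness thus replaces weak compactness, and no reduction to finitely many balls
  is made.
\<close>
lemma monotone_graph_common_point:
  fixes G :: "('a::{real_inner, complete_space} \<times> 'a) set"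
  assumes mono: "\<And>y v y' v'. (y, v) \<in> G \<Longrightarrow> (y', v') \<in> G \<Longrightarrow> inner (y - y') (v - v') \<ge> 0"
    and ne: "G \<noteq> {}"
  obtains z where "\<And>y v. (y, v) \<in> G \<Longrightarrow> inner (z - y) (z + v) \<le> 0"
proof -
  define K where "K = hull_graph G"
  \<comment> \<open>\<open>q\<close> is the centre of the ball and \<open>h\<close> the dual value; on the graph, \<open>- h\<close> is the squared radius.\<close>
  define q :: "'a \<times> 'a \<times> real \<Rightarrow> 'a" where "q = (\<lambda>(y, v, c). (1/2) *\<^sub>R (y - v))"
  define h where "h = (\<lambda>p::'a \<times> 'a \<times> real. - snd (snd p) - (norm (q p))\<^sup>2)"
  have K_ne: "K \<noteq> {}" and convex_K: "convex K"
    using ne by (auto simp: K_def hull_graph_def)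
  have in_K: "(y, v, inner y v) \<in> K" if "(y, v) \<in> G" for y v
    using that unfolding K_def hull_graph_def by (auto intro!: hull_inc)
  have h_le_0: "h p \<le> 0" if "p \<in> K" for p
  proof -
    obtain y v c where p: "p = (y, v, c)" by (metis prod_cases3)
    have "inner y v \<le> c"
      using hull_graph_above_duality_pairing[OF mono] that p K_def by blast
    moreover have "(norm (q p))\<^sup>2 + inner y v = (norm (y + v))\<^sup>2 / 4"
      by (simp add: q_def p power_divide power2_norm_eq_inner inner_diff_left inner_diff_right
          inner_add_left inner_add_right inner_commute[of v y] field_simps)
    ultimately show ?thesis
      using zero_le_power2[of "norm (y + v)"] unfolding h_def p snd_conv by linarith
  qed
  have h_mix: "h ((1 - t) *\<^sub>R p + t *\<^sub>R r) =
      (1 - t) * h p + t * h r + t * (1 - t) * (norm (q p - q r))\<^sup>2" for t p r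
  proof -
    have "linear q"
      unfolding q_def case_prod_beta by (rule linearI) (simp_all add: algebra_simps)
    then have "q ((1 - t) *\<^sub>R p + t *\<^sub>R r) = (1 - t) *\<^sub>R q p + t *\<^sub>R q r"
      by (simp add: linear_add linear_scale)
    then have "h ((1 - t) *\<^sub>R p + t *\<^sub>R r) = (1 - t) * (- snd (snd p)) + t * (- snd (snd r))
        - (norm ((1 - t) *\<^sub>R q p + t *\<^sub>R q r))\<^sup>2"
      by (simp add: h_def)
    then show ?thesis
      unfolding h_def norm_convex_combination_squared by algebra
  qed
  define S where "S = (SUP p\<in>K. h p)"
  have bdd: "bdd_above (h ` K)" using h_le_0 by (auto intro!: bdd_aboveI)
  have h_le_S: "h p \<le> S" if "p \<in> K" for p
    unfolding S_def using that bdd by (rule cSUP_upper)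
  have S_le_0: "S \<le> 0"
    unfolding S_def using K_ne h_le_0 by (rule cSUP_least)
  have "\<exists>p\<in>K. S - 1 / real (Suc n) < h p" for n
    using less_cSUP_iff[OF K_ne bdd, of "S - 1 / real (Suc n)"] unfolding S_def[symmetric] by simp
  then obtain p where pK: "\<And>n. p n \<in> K" and p_max: "\<And>n. S - 1 / real (Suc n) < h (p n)"
    by metis
  have mix_le: "(1 - t) * h p + t * h r + t * (1 - t) * (norm (q p - q r))\<^sup>2 \<le> S"
    if "p \<in> K" "r \<in> K" "0 \<le> t" "t \<le> 1" for p r t
    using h_le_S[OF convexD_alt[OF convex_K that]] h_mix by simp
  \<comment> \<open>The midpoint of two almost maximizing points cannot exceed the supremum.\<close>
  have close: "(norm (q (p m) - q (p n)))\<^sup>2 < 4 / real (Suc N)" if "N \<le> m" "N \<le> n" for m n N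
  proof -
    have "(norm (q (p m) - q (p n)))\<^sup>2 \<le> 4 * S - 2 * h (p m) - 2 * h (p n)"
      using mix_le[OF pK pK, of "1/2" m n] by (simp add: algebra_simps)
    moreover have "1 / real (Suc m) \<le> 1 / real (Suc N)" "1 / real (Suc n) \<le> 1 / real (Suc N)"
      using that by (auto intro!: divide_left_mono)
    ultimately show ?thesis using p_max[of m] p_max[of n] by simp
  qed
  have "Cauchy (\<lambda>n. q (p n))"
  proof (rule metric_CauchyI)
    fix e :: real assume "e > 0"
    then obtain N where N: "inverse (real (Suc N)) < e\<^sup>2 / 4"
      using reals_Archimedean[of "e\<^sup>2 / 4"] by auto
    have "dist (q (p m)) (q (p n)) < e" if "N \<le> m" "N \<le> n" for m n
    proof (rule power2_less_imp_less)
      show "(dist (q (p m)) (q (p n)))\<^sup>2 < e\<^sup>2"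
        using close[OF that] N by (simp add: dist_norm inverse_eq_divide)
    qed (use \<open>e > 0\<close> in simp)
    then show "\<exists>M. \<forall>m\<ge>M. \<forall>n\<ge>M. dist (q (p m)) (q (p n)) < e" by blast
  qed
  then obtain z where z: "(\<lambda>n. q (p n)) \<longlonglongrightarrow> z"
    using Cauchy_convergent convergent_def by blast
  have null: "(\<lambda>n. 1 / real (Suc n)) \<longlonglongrightarrow> 0"
    using LIMSEQ_inverse_real_of_nat by (simp only: inverse_eq_divide)
  have h_lim: "(\<lambda>n. h (p n)) \<longlonglongrightarrow> S"
  proof (rule real_tendsto_sandwich)
    show "\<forall>\<^sub>F n in sequentially. S - 1 / real (Suc n) \<le> h (p n)"
      using p_max by (intro always_eventually allI less_imp_le)
    show "\<forall>\<^sub>F n in sequentially. h (p n) \<le> S"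
      by (intro always_eventually allI h_le_S pK)
    show "(\<lambda>n. S - 1 / real (Suc n)) \<longlonglongrightarrow> S"
      using tendsto_diff[OF tendsto_const null] by (simp only: diff_zero)
  qed (rule tendsto_const)
  \<comment> \<open>Move from \<open>p n\<close> towards \<open>r\<close> by a fraction \<open>t\<close>; let \<open>n\<close> tend to infinity, then \<open>t\<close> to 0.\<close>
  have dist_le: "(norm (z - q r))\<^sup>2 \<le> - h r" if r: "r \<in> K" for r
  proof -
    have scaled: "h r + (1 - t) * (norm (z - q r))\<^sup>2 \<le> S" if "0 < t" "t \<le> 1" for t
    proof -
      have "(1 - t) * S + t * h r + t * (1 - t) * (norm (z - q r))\<^sup>2 \<le> S"
      proof (rule LIMSEQ_le_const2)
        show "(\<lambda>n. (1 - t) * h (p n) + t * h r + t * (1 - t) * (norm (q (p n) - q r))\<^sup>2)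
          \<longlonglongrightarrow> (1 - t) * S + t * h r + t * (1 - t) * (norm (z - q r))\<^sup>2"
          by (intro tendsto_intros z h_lim)
      qed (use mix_le[OF pK r] that in auto)
      then have "t * (h r + (1 - t) * (norm (z - q r))\<^sup>2) \<le> t * S"
        by (simp add: algebra_simps)
      then show ?thesis using \<open>0 < t\<close> by simp
    qed
    have "h r + (1 - 0) * (norm (z - q r))\<^sup>2 \<le> S"
    proof (rule LIMSEQ_le_const2)
      show "(\<lambda>n. h r + (1 - 1 / real (Suc n)) * (norm (z - q r))\<^sup>2)
          \<longlonglongrightarrow> h r + (1 - 0) * (norm (z - q r))\<^sup>2"
        by (intro tendsto_intros null)
    qed (use scaled in auto)
    then show ?thesis using S_le_0 by simp
  qed
  show thesis
  proof
    fix y v assume "(y, v) \<in> G"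
    define m where "m = (1/2) *\<^sub>R (y - v)"
    have "(norm (z - m))\<^sup>2 \<le> inner y v + (norm m)\<^sup>2"
      using dist_le[OF in_K[OF \<open>(y, v) \<in> G\<close>]] by (simp add: h_def q_def m_def)
    then have "inner z z - 2 * inner z m \<le> inner y v"
      by (simp add: power2_norm_eq_inner inner_diff_left inner_diff_right inner_commute[of m z])
    moreover have "2 * inner z m = inner z y - inner z v"
      by (simp add: m_def inner_diff_right)
    ultimately show "inner (z - y) (z + v) \<le> 0"
      by (simp add: inner_diff_left inner_add_right inner_commute[of y z])
  qed
qed

text \<open>
  A point that is monotonically related to the whole graph can be added to it without destroying
  monotonicity.
\<close>
lemma maximally_monotone_mem:
  assumes T: "maximally_monotone T"
    and rel: "\<And>y v. v \<in> T y \<Longrightarrow> inner (z - y) (u - v) \<ge> 0"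
  shows "u \<in> T z"
proof -
  define S where "S = T(z := insert u (T z))"
  have "monotone_operator S"
    unfolding monotone_operator_def
  proof (intro allI ballI)
    fix y y' v v' assume "v \<in> S y" "v' \<in> S y'"
    then have "v \<in> T y \<or> y = z \<and> v = u" "v' \<in> T y' \<or> y' = z \<and> v' = u"
      by (auto simp: S_def split: if_splits)
    moreover have "inner (y - y') (v - v') \<ge> 0" if "v \<in> T y" "v' \<in> T y'"
      using T that by (auto simp: maximally_monotone_def monotone_operator_def)
    moreover have "inner (y - z) (v - u) \<ge> 0" if "v \<in> T y" for y v
      using rel[OF that] by (metis inner_minus_left inner_minus_right minus_diff_eq minus_minus)
    ultimately show "inner (y - y') (v - v') \<ge> 0"
      using rel by auto
  qed
  moreover have "\<forall>y. T y \<subseteq> S y" by (auto simp: S_def)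
  ultimately have "S = T" using T by (auto simp: maximally_monotone_def)
  then have "S z = T z" by simp
  then show ?thesis by (auto simp: S_def)
qed

text \<open>
  With \<open>u = (w - z) / lam\<close>, the point \<open>(z, u)\<close> is monotonically related to \<open>(y, v)\<close> exactly if
  \<open>\<langle>z - y, z + (lam v - w)\<rangle> \<le> 0\<close>. So \<open>z\<close> is a common point of the balls of the graph of
  \<open>lam T - w\<close>.
\<close>
theorem Minty:
  fixes T :: "'a::{real_inner, complete_space} \<Rightarrow> 'a set"
  assumes T: "maximally_monotone T" and "lam > 0"
  obtains z u where "u \<in> T z" "w = z + lam *\<^sub>R u"
proof -
  define G where "G = {(y, lam *\<^sub>R v - w) | y v. v \<in> T y}"
  have "T y = {}" if "G = {}" for y
    using that by (auto simp: G_def)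
  then have "G \<noteq> {}"
    using maximally_monotone_mem[OF T] by blast
  have mono: "inner (y - y') (v - v') \<ge> 0" if yv: "(y, v) \<in> G" "(y', v') \<in> G" for y v y' v'
  proof -
    obtain s s' where s: "v = lam *\<^sub>R s - w" "v' = lam *\<^sub>R s' - w" "s \<in> T y" "s' \<in> T y'"
      using yv by (auto simp: G_def)
    then have "inner (y - y') (s - s') \<ge> 0"
      using T by (auto simp: maximally_monotone_def monotone_operator_def)
    moreover have "v - v' = lam *\<^sub>R (s - s')" by (simp add: s algebra_simps)
    ultimately show ?thesis using \<open>lam > 0\<close> by simp
  qed
  obtain z where z: "\<And>y v. (y, v) \<in> G \<Longrightarrow> inner (z - y) (z + v) \<le> 0"
    using monotone_graph_common_point[OF mono \<open>G \<noteq> {}\<close>] by blast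
  define u where "u = (1 / lam) *\<^sub>R (w - z)"
  have "u \<in> T z"
  proof (rule maximally_monotone_mem[OF T])
    fix y v assume "v \<in> T y"
    then have "inner (z - y) (z + (lam *\<^sub>R v - w)) \<le> 0"
      by (intro z) (auto simp: G_def)
    moreover have "z + (lam *\<^sub>R v - w) = (- lam) *\<^sub>R (u - v)"
      using \<open>lam > 0\<close> by (simp add: u_def algebra_simps)
    ultimately have "lam * inner (z - y) (u - v) \<ge> 0" by simp
    then show "inner (z - y) (u - v) \<ge> 0"
      using \<open>lam > 0\<close> by (simp add: zero_le_mult_iff)
  qed
  moreover have "w = z + lam *\<^sub>R u" using \<open>lam > 0\<close> by (simp add: u_def)
  ultimately show thesis by (rule that)
qed

section \<open>The Yosida regularization\<close>

lemma resolvent_eqI: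
  assumes "monotone_operator T" and "lam > 0" and u: "u \<in> T z" and w: "w = z + lam *\<^sub>R u"
  shows "resolvent lam T w = z"
  unfolding resolvent_def
proof (rule the_equality)
  fix z' assume "\<exists>u\<in>T z'. w = z' + lam *\<^sub>R u"
  then obtain u' where u': "u' \<in> T z'" "w = z' + lam *\<^sub>R u'" by blast
  have "z' - z = (- lam) *\<^sub>R (u' - u)" using w u'(2) by (simp add: algebra_simps)
  moreover have "inner (z' - z) (u' - u) \<ge> 0"
    using assms(1) u u'(1) by (auto simp: monotone_operator_def)
  ultimately have "lam * inner (u' - u) (u' - u) \<le> 0" by simp
  then have "inner (u' - u) (u' - u) \<le> 0"
    using \<open>lam > 0\<close> by (simp add: mult_le_0_iff)
  then have "inner (u' - u) (u' - u) = 0" by (intro antisym inner_ge_zero)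
  then have "u' = u" by simp
  then show "z' = z" using w u'(2) by simp
qed (use u w in blast)

text \<open>
  Here \<open>w - lam *\<^sub>R yosida lam T w\<close> is the resolvent at \<open>w\<close>. In this form the lemma carries all that
  is used about the resolvent at arbitrary points.
\<close>
lemma yosida_mem:
  fixes T :: "'a::{real_inner, complete_space} \<Rightarrow> 'a set"
  assumes T: "maximally_monotone T" and "lam > 0"
  shows "yosida lam T w \<in> T (w - lam *\<^sub>R yosida lam T w)"
proof -
  obtain z u where zu: "u \<in> T z" "w = z + lam *\<^sub>R u"
    using Minty[OF assms] by blast
  then have "resolvent lam T w = z"
    using T \<open>lam > 0\<close> by (intro resolvent_eqI[of T]) (simp_all add: maximally_monotone_def)
  then have "yosida lam T w = u"
    using \<open>lam > 0\<close> zu(2) by (simp add: yosida_def)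
  then show ?thesis using zu by simp
qed

lemma yosida_monotone:
  fixes T :: "'a::{real_inner, complete_space} \<Rightarrow> 'a set"
  assumes T: "maximally_monotone T" and "lam > 0"
  shows "inner (w - w') (yosida lam T w - yosida lam T w') \<ge> 0"
proof -
  define u u' where "u = yosida lam T w" and "u' = yosida lam T w'"
  have "inner ((w - lam *\<^sub>R u) - (w' - lam *\<^sub>R u')) (u - u') \<ge> 0"
    using T yosida_mem[OF assms]
    unfolding maximally_monotone_def monotone_operator_def u_def u'_def by blast
  moreover have "w - w' = (w - lam *\<^sub>R u) - (w' - lam *\<^sub>R u') + lam *\<^sub>R (u - u')"
    by (simp add: algebra_simps)
  then have "inner (w - w') (u - u') =
      inner ((w - lam *\<^sub>R u) - (w' - lam *\<^sub>R u')) (u - u') + lam * inner (u - u') (u - u')"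
    by (metis inner_add_left inner_scaleR_left)
  ultimately show ?thesis
    using \<open>lam > 0\<close> by (simp add: u_def u'_def)
qed

lemma yosida_zero:
  assumes "monotone_operator T" and "lam > 0" and "0 \<in> T z"
  shows "yosida lam T z = 0"
  using resolvent_eqI[OF assms, of z] by (simp add: yosida_def)

lemma gap_le_residual:
  assumes mono: "\<And>w w'. inner (w - w') (yosida lam T w - yosida lam T w') \<ge> 0"
  shows "gap lam T x0 D w \<le> ereal ((norm (w - x0) + D) * norm (yosida lam T w))"
  unfolding gap_def
proof (rule SUP_least)
  fix y assume "y \<in> {y. norm (y - x0) \<le> D}"
  then have y: "norm (y - x0) \<le> D" by simp
  have "inner (w - y) (yosida lam T y) \<le> inner (w - y) (yosida lam T w)"
    using mono[of w y] by (simp add: inner_diff_right)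
  also have "\<dots> \<le> norm (w - y) * norm (yosida lam T w)"
    by (rule norm_cauchy_schwarz)
  also have "\<dots> \<le> (norm (w - x0) + D) * norm (yosida lam T w)"
    using y norm_triangle_ineq4[of "w - x0" "y - x0"] by (intro mult_right_mono) auto
  finally show "ereal (inner (w - y) (yosida lam T y))
      \<le> ereal ((norm (w - x0) + D) * norm (yosida lam T w))" by simp
qed

section \<open>The energy estimate\<close>

text \<open>
  Put \<open>w = a t' + A (t' - t)\<close>, so that \<open>v - z = (v' - z) + (w + g)\<close>. Expanding the square, it
  remains to bound \<open>\<langle>v' - z, w\<rangle>\<close> from below. Since \<open>v' - z = (x' - z) + (A / a) (x' - x)\<close>, this inner
  product is exactly the increase of \<open>A \<langle>x - z, t\<rangle>\<close> plus the multiple \<open>A + A\<^sup>2 / a\<close> of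
  \<open>\<langle>x' - x, t' - t\<rangle>\<close>.
\<close>
lemma energy_step:
  fixes x x' v v' t t' g z :: "'a::real_inner"
  assumes "a > 0" "A \<ge> 0"
    and mono: "inner (x' - x) (t' - t) \<ge> 0"
    and v': "a *\<^sub>R v' = (a + A) *\<^sub>R x' - A *\<^sub>R x"
    and step: "0 = (a + A) *\<^sub>R t' - A *\<^sub>R t + v' - v + g"
  shows "(norm (v' - z))\<^sup>2 + 2 * (a + A) * inner (x' - z) t'
    \<le> (norm (v - z))\<^sup>2 + 2 * A * inner (x - z) t + 2 * norm g * norm (v' - z)"
proof -
  define r where "r = A / a"
  define X d e V where "X = x' - z" and "d = x' - x" and "e = t' - t" and "V = v' - z"
  define w where "w = a *\<^sub>R t' + A *\<^sub>R e"
  have "r \<ge> 0" and A: "A = r * a" using assms(1,2) by (auto simp: r_def)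
  have "a *\<^sub>R v' = a *\<^sub>R (x' + r *\<^sub>R d)"
    by (simp add: v' A d_def algebra_simps)
  then have V: "V = X + r *\<^sub>R d" using \<open>a > 0\<close> by (simp add: V_def X_def)
  have vz: "v - z = V + (w + g)"
    using step by (simp add: V_def w_def e_def algebra_simps)
  have "inner V w = a * inner X t' + A * inner X e + A * inner d t' + r * A * inner d e"
    by (simp add: V w_def A inner_add_left inner_add_right algebra_simps)
  also have "\<dots> = (a + A) * inner X t' - A * inner (x - z) t + (A + r * A) * inner d e"
  proof -
    have "x - z = X - d" "t = t' - e" by (simp_all add: X_def d_def e_def)
    show ?thesis
      unfolding \<open>x - z = X - d\<close> \<open>t = t' - e\<close>
      by (simp add: inner_diff_left inner_diff_right algebra_simps)
  qed
  finally have Vw: "(a + A) * inner X t' - A * inner (x - z) t \<le> inner V w"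
    using mono \<open>A \<ge> 0\<close> \<open>r \<ge> 0\<close> by (simp add: d_def e_def)
  have "(norm (v - z))\<^sup>2 = (norm V)\<^sup>2 + 2 * inner V (w + g) + (norm (w + g))\<^sup>2"
    unfolding vz power2_norm_eq_inner by (simp add: algebra_simps inner_commute)
  moreover have "inner V (w + g) \<ge> inner V w - norm g * norm V"
    using Cauchy_Schwarz_ineq2[of V g] by (simp add: inner_add_right abs_le_iff mult.commute)
  ultimately have "(norm V)\<^sup>2 + 2 * inner V w \<le> (norm (v - z))\<^sup>2 + 2 * (norm g * norm V)"
    using zero_le_power2[of "norm (w + g)"] by linarith
  with Vw show ?thesis by (simp add: V_def X_def algebra_simps)
qed

text \<open>
  The error term is multiplied by \<open>s\<close>, which only the new energy \<open>E'\<close> controls. Completing the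
  square in \<open>sqrt E'\<close> turns this implicit bound into an explicit one, with additive increments
  that can be summed.
\<close>
lemma sqrt_gronwall_step:
  fixes E E' d s :: real
  assumes "0 \<le> E" "0 \<le> d" "s\<^sup>2 \<le> E'" "E' \<le> E + 2 * d * s"
  shows "sqrt E' \<le> sqrt E + 2 * d"
proof -
  have E': "E' \<ge> 0" using assms(3) zero_le_power2[of s] by linarith
  have "s \<le> sqrt E'" using assms(3) by (rule real_le_rsqrt)
  then have "2 * d * s \<le> 2 * d * sqrt E'" using assms(2) by (intro mult_left_mono) auto
  then have "(sqrt E')\<^sup>2 \<le> (sqrt E)\<^sup>2 + 2 * d * sqrt E'"
    using assms(1,4) E' by simp
  then have "(sqrt E' - d)\<^sup>2 \<le> (sqrt E)\<^sup>2 + d\<^sup>2" by (simp add: power2_diff mult_ac)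
  also have "\<dots> \<le> (sqrt E + d)\<^sup>2" using assms(1,2) by (simp add: power2_sum)
  finally have "sqrt E' - d \<le> sqrt E + d"
    by (rule power2_le_imp_le) (use assms(1,2) in simp)
  then show ?thesis by simp
qed

lemma ppa_A_pos:
  assumes "\<And>k. a k > 0"
  shows "ppa_A a k > 0"
  using assms by (induction k) (auto intro: add_pos_pos)

lemma ppa_average:
  assumes "a (Suc k) \<noteq> 0"
  shows "a (Suc k) *\<^sub>R ppa_v a x (Suc k) =
    (a (Suc k) + ppa_A a k) *\<^sub>R x (Suc k) - ppa_A a k *\<^sub>R x k"
  using assms by (simp add: ppa_v_def)

text \<open>
  The definition of \<open>ppa_v\<close> makes \<open>x\<^sub>k\<^sub>+\<^sub>1\<close> a convex combination of \<open>x\<^sub>k\<close> and \<open>v\<^sub>k\<^sub>+\<^sub>1\<close>, and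
  \<open>x\<^sub>0 = v\<^sub>0\<close>; so the \<open>x\<^sub>k\<close> stay in every ball that contains the \<open>v\<^sub>k\<close>.
\<close>
lemma norm_average_le:
  assumes a: "\<And>k. a k > 0" and v: "\<And>k. norm (ppa_v a x k - z) \<le> M"
  shows "norm (x k - z) \<le> M"
proof (induction k)
  case 0
  then show ?case using v[of 0] a[of 0] by (simp add: ppa_v_def)
next
  case (Suc k)
  let ?A = "ppa_A a k" and ?a = "a (Suc k)"
  have A: "?A > 0" by (rule ppa_A_pos) (rule a)
  have "(?a + ?A) *\<^sub>R (x (Suc k) - z) = ?A *\<^sub>R (x k - z) + ?a *\<^sub>R (ppa_v a x (Suc k) - z)"
    using ppa_average[of a k x] a[of "Suc k"] by (simp add: algebra_simps)
  then have "(?a + ?A) * norm (x (Suc k) - z)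
      = norm (?A *\<^sub>R (x k - z) + ?a *\<^sub>R (ppa_v a x (Suc k) - z))"
    using A a[of "Suc k"] by (metis abs_of_pos add_pos_pos norm_scaleR)
  also have "\<dots> \<le> ?A * norm (x k - z) + ?a * norm (ppa_v a x (Suc k) - z)"
    using norm_triangle_ineq[of "?A *\<^sub>R (x k - z)"] A a[of "Suc k"]
    by (metis abs_of_pos norm_scaleR)
  also have "\<dots> \<le> ?A * M + ?a * M"
    using Suc v[of "Suc k"] A a[of "Suc k"] by (intro add_mono mult_left_mono) auto
  finally have "(?a + ?A) * norm (x (Suc k) - z) \<le> (?a + ?A) * M"
    by (simp add: algebra_simps)
  then show ?case using A a[of "Suc k"] by simp
qed

lemma ppa_v_bounded:
  fixes x t g :: "nat \<Rightarrow> 'a::real_inner"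
  assumes a: "\<And>k. a k > 0"
    and mono: "\<And>k. inner (x (Suc k) - x k) (t (Suc k) - t k) \<ge> 0"
    and zero: "\<And>k. inner (x k - z) (t k) \<ge> 0"
    and step: "\<And>k. 0 = ppa_A a (Suc k) *\<^sub>R t (Suc k) - ppa_A a k *\<^sub>R t k
                  + ppa_v a x (Suc k) - ppa_v a x k + g k"
    and sum: "summable (\<lambda>k. norm (g k))"
  obtains M where "\<And>k. norm (ppa_v a x k - z) \<le> M"
proof -
  define E where "E k = (norm (ppa_v a x k - z))\<^sup>2 + 2 * ppa_A a k * inner (x k - z) (t k)" for k
  have A: "ppa_A a k > 0" for k by (rule ppa_A_pos) (rule a)
  have v_le: "(norm (ppa_v a x k - z))\<^sup>2 \<le> E k" for k
    using zero[of k] A[of k] by (simp add: E_def)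
  have E_pos: "E k \<ge> 0" for k
    using v_le[of k] zero_le_power2 order_trans by blast
  have E_step: "E (Suc k) \<le> E k + 2 * norm (g k) * norm (ppa_v a x (Suc k) - z)" for k
  proof -
    have "0 = (a (Suc k) + ppa_A a k) *\<^sub>R t (Suc k) - ppa_A a k *\<^sub>R t k
        + ppa_v a x (Suc k) - ppa_v a x k + g k"
      using step[of k] by simp
    from energy_step[OF a[of "Suc k"] less_imp_le[OF A[of k]] mono[of k]
        ppa_average[of a k x] this, of z]
    show ?thesis using a[of "Suc k"] by (simp add: E_def)
  qed
  have sqrt_E: "sqrt (E k) \<le> sqrt (E 0) + 2 * (\<Sum>i<k. norm (g i))" for k
  proof (induction k)
    case (Suc k)
    then show ?case
      using sqrt_gronwall_step[OF E_pos[of k] norm_ge_zero[of "g k"] v_le[of "Suc k"] E_step[of k]] by simp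
  qed simp
  have "norm (ppa_v a x k - z) \<le> sqrt (E 0) + 2 * (\<Sum>i. norm (g i))" for k
  proof -
    have "(\<Sum>i<k. norm (g i)) \<le> (\<Sum>i. norm (g i))"
      using sum by (intro sum_le_suminf) auto
    moreover have "norm (ppa_v a x k - z) \<le> sqrt (E k)"
      using v_le by (rule real_le_rsqrt)
    ultimately show ?thesis using sqrt_E[of k] by linarith
  qed
  then show thesis by (rule that)
qed

lemma ppa_residual_bounded:
  fixes x t g :: "nat \<Rightarrow> 'a::real_inner"
  assumes v: "\<And>k. norm (ppa_v a x k - z) \<le> M"
    and step: "\<And>k. 0 = ppa_A a (Suc k) *\<^sub>R t (Suc k) - ppa_A a k *\<^sub>R t k
                  + ppa_v a x (Suc k) - ppa_v a x k + g k"
    and sum: "summable (\<lambda>k. norm (g k))"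
  obtains C where "\<And>k. norm (ppa_A a k *\<^sub>R t k) \<le> C"
proof -
  define c where "c = ppa_A a 0 *\<^sub>R t 0 + (ppa_v a x 0 - z)"
  have telescope: "ppa_A a k *\<^sub>R t k = c - (ppa_v a x k - z) - (\<Sum>i<k. g i)" for k
  proof (induction k)
    case (Suc k)
    have "ppa_A a (Suc k) *\<^sub>R t (Suc k) = ppa_A a k *\<^sub>R t k
        - ppa_v a x (Suc k) + ppa_v a x k - g k"
      using step[of k] by (simp add: algebra_simps)
    then show ?case unfolding Suc.IH by simp
  qed (simp add: c_def)
  have "norm (ppa_A a k *\<^sub>R t k) \<le> norm c + M + (\<Sum>i. norm (g i))" for k
  proof -
    have "norm (ppa_A a k *\<^sub>R t k)
        \<le> norm c + norm (ppa_v a x k - z) + norm (\<Sum>i<k. g i)"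
      unfolding telescope by (meson add_mono norm_triangle_ineq4 order_refl order_trans)
    moreover have "norm (\<Sum>i<k. g i) \<le> (\<Sum>i. norm (g i))"
      using sum by (intro order_trans[OF norm_sum] sum_le_suminf) auto
    ultimately show ?thesis using v[of k] by linarith
  qed
  then show thesis by (rule that)
qed

theorem theorem2:
  fixes T :: "'a::{real_inner, complete_space} \<Rightarrow> 'a set"
    and x :: "nat \<Rightarrow> 'a"
    and a \<delta> :: "nat \<Rightarrow> real"
    and lam \<epsilon> D :: real
  assumes "maximally_monotone T"
    and "{z. 0 \<in> T z} \<noteq> {}"
    and "bounded {z. 0 \<in> T z}"
    and "lam > 0"
    and "D > 0"
    and "contracting_ppa lam T \<epsilon> a \<delta> x"
  shows "(\<exists>C. \<forall>k. norm (yosida lam T (x (Suc k))) \<le> C * (1 / ppa_A a (Suc k))) \<and>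
         (\<exists>C. \<forall>k. gap lam T (x 0) D (x (Suc k)) \<le> ereal (C * (1 / ppa_A a (Suc k))))"
proof -
  define t where "t k = yosida lam T (x k)" for k
  obtain z where z: "0 \<in> T z" using assms(2) by blast
  have "\<epsilon> > 0" "a 0 > 0" "\<forall>k. a (Suc k) \<ge> \<epsilon>" "summable \<delta>"
    and "\<exists>g. \<forall>k. norm (g k) \<le> \<delta> k \<and>
        0 = ppa_A a (Suc k) *\<^sub>R t (Suc k) - ppa_A a k *\<^sub>R t k
            + ppa_v a x (Suc k) - ppa_v a x k + g k"
    using assms(6) by (auto simp only: contracting_ppa_def t_def)
  then obtain g where g: "\<And>k. norm (g k) \<le> \<delta> k"
    and step: "\<And>k. 0 = ppa_A a (Suc k) *\<^sub>R t (Suc k) - ppa_A a k *\<^sub>R t k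
                  + ppa_v a x (Suc k) - ppa_v a x k + g k"
    by blast
  have sum: "summable (\<lambda>k. norm (g k))"
    by (rule summable_comparison_test'[OF \<open>summable \<delta>\<close>, of 0]) (simp add: g)
  have "a (Suc k) > 0" for k
    using \<open>\<epsilon> > 0\<close> \<open>\<forall>k. a (Suc k) \<ge> \<epsilon>\<close> less_le_trans by blast
  then have a: "a k > 0" for k
    using \<open>a 0 > 0\<close> by (cases k) simp_all
  have A: "ppa_A a k > 0" for k by (rule ppa_A_pos) (rule a)
  note mono = yosida_monotone[OF \<open>maximally_monotone T\<close> \<open>lam > 0\<close>]
  have "yosida lam T z = 0"
    using yosida_zero z \<open>lam > 0\<close> \<open>maximally_monotone T\<close> unfolding maximally_monotone_def by blast
  then have zero: "inner (x k - z) (t k) \<ge> 0" for k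
    using mono[of "x k" z] by (simp add: t_def)
  have mono_x: "inner (x (Suc k) - x k) (t (Suc k) - t k) \<ge> 0" for k
    unfolding t_def by (rule mono)
  obtain M where M: "\<And>k. norm (ppa_v a x k - z) \<le> M"
    using ppa_v_bounded[OF a mono_x zero step sum] by blast
  obtain C where C: "\<And>k. norm (ppa_A a k *\<^sub>R t k) \<le> C"
    using ppa_residual_bounded[OF M step sum] by blast
  have residual: "norm (t k) \<le> C * (1 / ppa_A a k)" for k
    using C[of k] A[of k] by (simp add: pos_le_divide_eq mult.commute)
  have x_le: "norm (x k - x 0) \<le> 2 * M" for k
    using norm_average_le[OF a M, of k] norm_average_le[OF a M, of 0]
      norm_triangle_ineq4[of "x k - z" "x 0 - z"] by simp
  have "gap lam T (x 0) D (x k) \<le> ereal ((2 * M + D) * C * (1 / ppa_A a k))" for k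
  proof -
    have "gap lam T (x 0) D (x k) \<le> ereal ((norm (x k - x 0) + D) * norm (t k))"
      unfolding t_def by (rule gap_le_residual[OF mono])
    moreover have "2 * M + D \<ge> 0"
      using x_le[of k] \<open>D > 0\<close> norm_ge_zero[of "x k - x 0"] by linarith
    then have "(norm (x k - x 0) + D) * norm (t k) \<le> (2 * M + D) * (C * (1 / ppa_A a k))"
      using x_le[of k] residual[of k] by (intro mult_mono) auto
    ultimately show ?thesis by (simp add: mult.assoc order_trans)
  qed
  with residual show ?thesis unfolding t_def by blast
qed

end
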